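(* Let $\mathbb{F}$ be a field and let $n\ge 2$ be an integer. Then the singular difference graph $\Gamma$ of $M_n(\mathbb{F})$ is regular, that is, every vertex of $\Gamma$ has the same degree.
   Context: $M_n(\mathbb{F})$ is the vector space of all $n\times n$ matrices over $\mathbb{F}$. The singular difference graph $\Gamma$ of $M_n(\mathbb{F})$ is the simple (possibly infinite) graph with vertex set $M_n(\mathbb{F})$ in which two distinct matrices $A,B$ are adjacent if and only if $\det(A-B)=0$. The degree of a vertex is the cardinality of the set of vertices adjacent to it. *)

theory Defs
  imports Jordan_Normal_Form.Determinant Graph_Theory.Pair_Digraph
begin

unbundle cardinal_syntax

text \<open>
  A simple, possibly infinite, undirected graph is represented by a symmetric loop-free set of
  ordered pairs, i.e. by an instance of \<^locale>\<open>pair_bidirected_digraph\<close>; the edge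
  between \<open>A\<close> and \<open>B\<close> is the pair of arcs \<open>(A, B)\<close>, \<open>(B, A)\<close>.
  Unlike \<^locale>\<open>pair_graph\<close>, that locale does not assume finiteness.
\<close>

definition singular_difference_graph :: "nat \<Rightarrow> 'a::field mat pair_pre_digraph" where
  "singular_difference_graph n =
     \<lparr> pverts = carrier_mat n n,
       parcs = {(A, B). A \<in> carrier_mat n n \<and> B \<in> carrier_mat n n \<and> A \<noteq> B \<and> det (A - B) = 0} \<rparr>"

lemma pair_bidirected_digraph_singular_difference_graph:
  "pair_bidirected_digraph (singular_difference_graph n :: 'a::field mat pair_pre_digraph)"
proof -
  have swap: "det (B - A) = 0"
    if A: "A \<in> carrier_mat n n" and B: "B \<in> carrier_mat n n" and "det (A - B) = 0"
    for A B :: "'a mat"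
  proof -
    have "B - A = (-1) \<cdot>\<^sub>m (A - B)"
      using A B by (intro eq_matI) auto
    then show ?thesis
      using that by simp
  qed
  have "sym (parcs (singular_difference_graph n :: 'a mat pair_pre_digraph))"
    by (auto simp: sym_def singular_difference_graph_def intro: swap)
  then show ?thesis
    by unfold_locales (auto simp: singular_difference_graph_def symmetric_def)
qed

definition graph_neighbours :: "'v pair_pre_digraph \<Rightarrow> 'v \<Rightarrow> 'v set" where
  "graph_neighbours G v = {w \<in> pverts G. (v, w) \<in> parcs G}"

text \<open>
  Degrees may be infinite, so they are HOL cardinals (well-orders of minimal type), which have to
  be compared with \<open>=o\<close>. The operators \<^const>\<open>card\<close> and
  \<^const>\<open>out_degree\<close> would return \<open>0\<close> for every infinite neighbourhood.
\<close>

definition graph_degree :: "'v pair_pre_digraph \<Rightarrow> 'v \<Rightarrow> 'v rel" where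
  "graph_degree G v = |graph_neighbours G v|"

definition regular_graph :: "'v pair_pre_digraph \<Rightarrow> bool" where
  "regular_graph G \<longleftrightarrow> (\<forall>u \<in> pverts G. \<forall>v \<in> pverts G. graph_degree G u =o graph_degree G v)"

end

theory Submission
  imports Defs
begin

text \<open>
  Adjacency depends only on the difference of two matrices, so every translation
  \<open>X \<mapsto> X + T\<close> is an automorphism of the graph. The translations act transitively on
  the vertices: \<open>T = V - U\<close> moves \<open>U\<close> to \<open>V\<close>, hence maps the neighbours of \<open>U\<close>
  bijectively onto those of \<open>V\<close>. Exhibiting this bijection handles finite and infinite
  degrees alike.
\<close>

lemma graph_neighbours_singular_difference_graph_iff:
  assumes "U \<in> carrier_mat n n"
  shows "X \<in> graph_neighbours (singular_difference_graph n) U \<longleftrightarrow>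
    X \<in> carrier_mat n n \<and> U \<noteq> X \<and> det (U - X) = 0"
  using assms by (auto simp: graph_neighbours_def singular_difference_graph_def)

lemma translate_graph_neighbours_singular_difference_graph:
  fixes U V :: "'a::field mat"
  assumes U: "U \<in> carrier_mat n n" and V: "V \<in> carrier_mat n n"
    and X: "X \<in> graph_neighbours (singular_difference_graph n) U"
  shows "X + (V - U) \<in> graph_neighbours (singular_difference_graph n) V"
proof -
  have Xc: "X \<in> carrier_mat n n" and "U \<noteq> X" and det0: "det (U - X) = 0"
    using X graph_neighbours_singular_difference_graph_iff[OF U] by auto
  have diff: "V - (X + (V - U)) = U - X"
    using U V Xc by (intro eq_matI) auto
  have "V \<noteq> X + (V - U)"
  proof
    assume eq: "V = X + (V - U)"
    have "U = (X + (V - U)) - (V - U)"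
      unfolding eq[symmetric] using U V by (intro eq_matI) auto
    also have "\<dots> = X"
      using U V Xc by (intro eq_matI) auto
    finally show False
      using \<open>U \<noteq> X\<close> by contradiction
  qed
  moreover have "X + (V - U) \<in> carrier_mat n n"
    using U by (intro add_carrier_mat minus_carrier_mat)
  ultimately show ?thesis
    using V diff det0 by (simp add: graph_neighbours_singular_difference_graph_iff)
qed

lemma bij_betw_graph_neighbours_singular_difference_graph:
  fixes U V :: "'a::field mat"
  assumes U: "U \<in> carrier_mat n n" and V: "V \<in> carrier_mat n n"
  shows "bij_betw (\<lambda>X. X + (V - U)) (graph_neighbours (singular_difference_graph n) U)
    (graph_neighbours (singular_difference_graph n) V)"
proof (rule bij_betw_byWitness[where f' = "\<lambda>X. X + (U - V)"])
  have inverse: "X + (B - A) + (A - B) = X"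
    if "A \<in> carrier_mat n n" "B \<in> carrier_mat n n"
      and "X \<in> graph_neighbours (singular_difference_graph n) A" for A B X :: "'a mat"
    using that by (intro eq_matI) (auto simp: graph_neighbours_singular_difference_graph_iff)
  show "\<forall>X \<in> graph_neighbours (singular_difference_graph n) U. X + (V - U) + (U - V) = X"
    "\<forall>X \<in> graph_neighbours (singular_difference_graph n) V. X + (U - V) + (V - U) = X"
    using inverse U V by auto
qed (use U V in \<open>auto intro: translate_graph_neighbours_singular_difference_graph\<close>)

theorem theorem4p3:
  fixes n :: nat
  assumes "n \<ge> 2"
  shows "regular_graph (singular_difference_graph n :: 'a::field mat pair_pre_digraph)"
  unfolding regular_graph_def graph_degree_def
proof (intro ballI)
  fix U V :: "'a mat"
  assume "U \<in> pverts (singular_difference_graph n)" "V \<in> pverts (singular_difference_graph n)"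
  then have "U \<in> carrier_mat n n" "V \<in> carrier_mat n n"
    by (auto simp: singular_difference_graph_def)
  then show "|graph_neighbours (singular_difference_graph n) U| =o
      |graph_neighbours (singular_difference_graph n) V|"
    by (rule card_of_ordIsoI[OF bij_betw_graph_neighbours_singular_difference_graph])
qed

end
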